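(* Let $X$ be (the vertex set of) a simple connected regular graph, with common degree $\deg(X)$, equipped with the shortest path distance, such that the local case is critical for $(X,\#_X)$, i.e. $C_{\#_X}=C^0_{\#_X}$. If the standard random walk on $X$ is recurrent, then $C_X=\deg(X)+1$ and $\mathrm{DM}(X)=\{\alpha\,\#_X:\alpha>0\}$.
   Context: For a metric space $(X,d)$, write $B(x,r)=\{y\in X: d(y,x)<r\}$. A Borel regular measure $\mu$ on $X$ is doubling if there is a constant $C>0$ with $\mu(B(x,2r))\le C\mu(B(x,r))$ for all $x\in X$, $r>0$, and $0<\mu(B(x_0,r_0))<\infty$ for some $x_0\in X$, $r_0>0$ (then $0<\mu(B(x,r))<\infty$ for all $x\in X$, $r>0$). Its doubling constant is $C_\mu=\sup_{x\in X,\,r>0}\mu(B(x,2r))/\mu(B(x,r))$. The least doubling constant of $X$ is $C_X=\inf_\mu C_\mu$, the infimum being over all doubling measures on $X$. The set of doubling minimizers is $\mathrm{DM}(X)=\{\mu \text{ doubling measure on } X: C_\mu=C_X\}$. A graph is identified with its vertex set; $\#_X$ is the counting measure on $X$. The graph is regular if all vertices have the same finite number $\deg(X)$ of neighbors. For a measure $\mu$ on $X$, $C^0_\mu=\sup_{x\in X}\mu(B(x,2))/\mu(B(x,1))$ (note $B(x,1)=\{x\}$ and $B(x,2)$ is $x$ together with its neighbors); the local case is said to be critical for $(X,\mu)$ if $C_\mu=C^0_\mu$. The standard random walk on $X$ moves from a vertex to a uniformly chosen neighbor at each step. *)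

theory Defs
  imports "HOL-Probability.Probability"
begin

section \<open>Doubling measures on metric spaces\<close>

context Metric_space
begin

definition borel_sets :: "'a set set" where
  "borel_sets = sigma_sets M {U. openin mtopology U}"

text \<open>A Borel regular measure is a measure on a \<open>\<sigma>\<close>-algebra that contains the Borel sets,
  such that each measurable set lies in a Borel set of the same measure.\<close>

definition borel_regular :: "'a measure \<Rightarrow> bool" where
  "borel_regular \<mu> \<longleftrightarrow> space \<mu> = M \<and> borel_sets \<subseteq> sets \<mu> \<and>
     (\<forall>A\<in>sets \<mu>. \<exists>B\<in>borel_sets. A \<subseteq> B \<and> emeasure \<mu> B = emeasure \<mu> A)"

definition doubling_measure :: "'a measure \<Rightarrow> bool" where
  "doubling_measure \<mu> \<longleftrightarrow> borel_regular \<mu> \<and>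
     (\<exists>C::real. C > 0 \<and> (\<forall>x\<in>M. \<forall>r>0.
        emeasure \<mu> (mball x (2 * r)) \<le> ennreal C * emeasure \<mu> (mball x r))) \<and>
     (\<exists>x\<^sub>0\<in>M. \<exists>r\<^sub>0>0. 0 < emeasure \<mu> (mball x\<^sub>0 r\<^sub>0) \<and> emeasure \<mu> (mball x\<^sub>0 r\<^sub>0) < \<infinity>)"

definition doubling_const :: "'a measure \<Rightarrow> ennreal" where
  "doubling_const \<mu> =
     (SUP x\<in>M. SUP r\<in>{0<..}. emeasure \<mu> (mball x (2 * r)) / emeasure \<mu> (mball x r))"

definition local_doubling_const :: "'a measure \<Rightarrow> ennreal" where
  "local_doubling_const \<mu> = (SUP x\<in>M. emeasure \<mu> (mball x 2) / emeasure \<mu> (mball x 1))"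

definition least_doubling_const :: ennreal where
  "least_doubling_const = (INF \<mu>\<in>Collect doubling_measure. doubling_const \<mu>)"

definition doubling_minimizers :: "'a measure set" where
  "doubling_minimizers = {\<mu>. doubling_measure \<mu> \<and> doubling_const \<mu> = least_doubling_const}"

definition local_case_critical :: "'a measure \<Rightarrow> bool" where
  "local_case_critical \<mu> \<longleftrightarrow> doubling_const \<mu> = local_doubling_const \<mu>"

end

section \<open>Graphs and the shortest path distance\<close>

locale simple_connected_graph =
  fixes V :: "'a set" and E :: "('a \<times> 'a) set"
  assumes edges: "E \<subseteq> V \<times> V"
    and sym_edges: "sym E"
    and no_loops: "irrefl E"
    and nonempty: "V \<noteq> {}"
    and connected: "\<And>x y. x \<in> V \<Longrightarrow> y \<in> V \<Longrightarrow> (x, y) \<in> E\<^sup>*"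

definition regular_of_degree :: "'a set \<Rightarrow> ('a \<times> 'a) set \<Rightarrow> nat \<Rightarrow> bool" where
  "regular_of_degree V E k \<longleftrightarrow> (\<forall>x\<in>V. finite (E `` {x}) \<and> card (E `` {x}) = k)"

definition path_dist :: "('a \<times> 'a) set \<Rightarrow> 'a \<Rightarrow> 'a \<Rightarrow> real" where
  "path_dist E x y = real (LEAST n. (x, y) \<in> E ^^ n)"

lemma (in simple_connected_graph) Metric_space_path_dist: "Metric_space V (path_dist E)"
proof
  have ex: "\<exists>n. (x, y) \<in> E ^^ n" if "x \<in> V" "y \<in> V" for x y
    using connected[OF that] by (simp add: rtrancl_power)
  have swap: "(y, x) \<in> E ^^ n" if "(x, y) \<in> E ^^ n" for x y n
    using that
  proof (induction n arbitrary: y)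
    case (Suc n)
    then obtain z where "(x, z) \<in> E ^^ n" "(z, y) \<in> E" by auto
    with Suc.IH sym_edges show ?case
      by (metis relpow_Suc_I2 symD)
  qed auto
  fix x y
  show "0 \<le> path_dist E x y" by (simp add: path_dist_def)
  have "(\<lambda>n. (x, y) \<in> E ^^ n) = (\<lambda>n. (y, x) \<in> E ^^ n)"
    using swap by blast
  then show "path_dist E x y = path_dist E y x" by (simp add: path_dist_def)
  assume xy: "x \<in> V" "y \<in> V"
  have L: "(x, y) \<in> E ^^ (LEAST n. (x, y) \<in> E ^^ n)" if "x \<in> V" "y \<in> V" for x y
    using LeastI_ex[OF ex[OF that]] .
  show "path_dist E x y = 0 \<longleftrightarrow> x = y"
  proof
    assume "path_dist E x y = 0"
    with L[OF xy] show "x = y" by (simp add: path_dist_def)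
  next
    assume "x = y"
    then have "(x, y) \<in> E ^^ 0" by simp
    then have "(LEAST n. (x, y) \<in> E ^^ n) \<le> 0" by (rule Least_le)
    then show "path_dist E x y = 0" by (simp add: path_dist_def)
  qed
  fix z assume z: "z \<in> V"
  have "(x, z) \<in> E ^^ ((LEAST n. (x, y) \<in> E ^^ n) + (LEAST n. (y, z) \<in> E ^^ n))"
    unfolding relpow_add using L[OF xy] L[OF xy(2) z] by blast
  then have "(LEAST n. (x, z) \<in> E ^^ n) \<le> (LEAST n. (x, y) \<in> E ^^ n) + (LEAST n. (y, z) \<in> E ^^ n)"
    by (rule Least_le)
  then show "path_dist E x z \<le> path_dist E x y + path_dist E y z"
    unfolding path_dist_def by linarith
qed

section \<open>The standard random walk\<close>

text \<open>In a connected graph, a vertex without neighbors is the only vertex; the walk then stays put.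
  \<open>pmf_of_set\<close> needs the set of neighbors to be finite, which holds in regular graphs.\<close>

definition walk_step :: "('a \<times> 'a) set \<Rightarrow> 'a \<Rightarrow> 'a pmf" where
  "walk_step E x = (if E `` {x} = {} then return_pmf x else pmf_of_set (E `` {x}))"

definition walk_kernel :: "('a \<times> 'a) set \<Rightarrow> 'a \<Rightarrow> nat \<Rightarrow> (nat \<Rightarrow> 'a) \<Rightarrow> 'a measure" where
  "walk_kernel E x i \<omega> =
     measure_pmf (case i of 0 \<Rightarrow> return_pmf x | Suc n \<Rightarrow> walk_step E (\<omega> n))"

lemma Ionescu_Tulcea_walk: "Ionescu_Tulcea (walk_kernel E x) (\<lambda>_. count_space UNIV)"
  unfolding Ionescu_Tulcea_def
proof (intro conjI allI impI)
  fix i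
  show "walk_kernel E x i \<in> Pi\<^sub>M {0..<i} (\<lambda>_. count_space UNIV) \<rightarrow>\<^sub>M subprob_algebra (count_space UNIV)"
  proof (cases i)
    case 0
    then show ?thesis
      by (simp add: walk_kernel_def [abs_def] measure_pmf_in_subprob_algebra)
  next
    case (Suc n)
    have "(\<lambda>\<omega>. \<omega> n) \<in> Pi\<^sub>M {0..<i} (\<lambda>_. count_space UNIV) \<rightarrow>\<^sub>M count_space UNIV"
      using Suc by (intro measurable_component_singleton) auto
    moreover have "(\<lambda>y. measure_pmf (walk_step E y)) \<in> count_space UNIV \<rightarrow>\<^sub>M subprob_algebra (count_space UNIV)"
      by (simp add: measure_pmf_in_subprob_algebra)
    ultimately have "(\<lambda>\<omega>. measure_pmf (walk_step E (\<omega> n)))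
        \<in> Pi\<^sub>M {0..<i} (\<lambda>_. count_space UNIV) \<rightarrow>\<^sub>M subprob_algebra (count_space UNIV)"
      by (rule measurable_compose)
    then show ?thesis
      using Suc by (simp add: walk_kernel_def [abs_def])
  qed
next
  fix i \<omega>
  show "prob_space (walk_kernel E x i \<omega>)"
    by (simp add: walk_kernel_def measure_pmf.prob_space_axioms)
qed

interpretation walk: Ionescu_Tulcea "walk_kernel E x" "\<lambda>_. count_space UNIV" for E x
  by (rule Ionescu_Tulcea_walk)

text \<open>The law, on the space of trajectories, of the walk started at \<open>x\<close>, from the Ionescu-Tulcea
  theorem; its values on cylinders are computed below.\<close>

definition walk_measure :: "('a \<times> 'a) set \<Rightarrow> 'a \<Rightarrow> (nat \<Rightarrow> 'a) measure" where
  "walk_measure E x = walk.PF.lim E x"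

lemma emeasure_walk_measure:
  "emeasure (walk_measure E x) {\<omega>. \<forall>i\<le>n. \<omega> i = y i} =
     indicator {y 0} x * (\<Prod>i<n. ennreal (pmf (walk_step E (y i)) (y (Suc i))))"
proof -
  let ?M = "\<lambda>_::nat. count_space (UNIV :: 'a set)"
  define X where "X m = (\<Pi>\<^sub>E i\<in>{0..<m}. {y i})" for m :: nat
  have X_sets [measurable]: "X m \<in> sets (Pi\<^sub>M {0..<m} ?M)" for m
    unfolding X_def by (rule sets_PiM_I_finite) auto
  have C: "emeasure (walk.C E x 0 m (\<lambda>_. undefined)) (X m) =
      (\<Prod>i<m. emeasure (walk_kernel E x i y) {y i})" for m
  proof (induction m)
    case 0
    then show ?case
      using X_sets[of 0] by (simp add: X_def)
  next
    case (Suc m)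
    have start: "(\<lambda>_. undefined) \<in> space (Pi\<^sub>M {0..<0} ?M)"
      by (simp add: space_PiM)
    have sp: "space (walk.C E x 0 m (\<lambda>_. undefined)) = space (Pi\<^sub>M {0..<m} ?M)"
      using walk.space_C[OF start] by simp
    have st: "sets (walk.C E x 0 m (\<lambda>_. undefined)) = sets (Pi\<^sub>M {0..<m} ?M)"
      using walk.sets_C[OF start] by simp
    have eP: "emeasure (walk.eP E x m \<omega>) (X (Suc m)) =
        emeasure (walk_kernel E x m y) {y m} * indicator (X m) \<omega>"
      if "\<omega> \<in> space (Pi\<^sub>M {0..<m} ?M)" for \<omega>
    proof -
      have ext: "\<omega> i = undefined" if "\<not> i < m" for i
        using that \<open>\<omega> \<in> _\<close> by (auto simp: space_PiM PiE_def extensional_def)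
      have iff: "fun_upd \<omega> m z \<in> X (Suc m) \<longleftrightarrow> z = y m \<and> \<omega> \<in> X m" for z
        using ext by (auto simp: X_def PiE_iff extensional_def less_Suc_eq)
      have "emeasure (walk.eP E x m \<omega>) (X (Suc m)) =
          emeasure (walk_kernel E x m \<omega>) (fun_upd \<omega> m -` X (Suc m) \<inter> UNIV)"
        using walk.emeasure_eP[OF that X_sets] by simp
      also have "fun_upd \<omega> m -` X (Suc m) \<inter> UNIV = (if \<omega> \<in> X m then {y m} else {})"
        using iff by auto
      also have "emeasure (walk_kernel E x m \<omega>) (if \<omega> \<in> X m then {y m} else {}) =
          emeasure (walk_kernel E x m y) {y m} * indicator (X m) \<omega>"
      proof (cases "\<omega> \<in> X m")
        case True
        then have "walk_kernel E x m \<omega> = walk_kernel E x m y"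
          by (auto simp: walk_kernel_def X_def PiE_iff split: nat.split)
        with True show ?thesis by simp
      qed simp
      finally show ?thesis .
    qed
    have "emeasure (walk.C E x 0 (Suc m) (\<lambda>_. undefined)) (X (Suc m)) =
        (\<integral>\<^sup>+\<omega>. emeasure (walk.eP E x m \<omega>) (X (Suc m)) \<partial>walk.C E x 0 m (\<lambda>_. undefined))"
      unfolding walk.C.simps add_0
      by (rule emeasure_bind[where N = "Pi\<^sub>M {0..<Suc m} ?M"])
         (auto simp: sp walk.space_PiM_not_empty space_PiM_empty_iff
               intro: measurable_cong_sets[OF st refl, THEN equalityD2, THEN subsetD] walk.measurable_eP X_sets)
    also have "\<dots> = (\<integral>\<^sup>+\<omega>. emeasure (walk_kernel E x m y) {y m} * indicator (X m) \<omega>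
        \<partial>walk.C E x 0 m (\<lambda>_. undefined))"
      by (rule nn_integral_cong) (simp add: sp eP)
    also have "\<dots> = emeasure (walk_kernel E x m y) {y m} *
        emeasure (walk.C E x 0 m (\<lambda>_. undefined)) (X m)"
      by (rule nn_integral_cmult_indicator) (simp add: st)
    finally show ?case
      by (simp add: Suc.IH mult.commute)
  qed
  have "{\<omega>. \<forall>i\<le>n. \<omega> i = y i} = prod_emb UNIV ?M {0..<Suc n} (X (Suc n))"
    by (auto simp: prod_emb_def X_def PiE_iff less_Suc_eq_le)
  then have "emeasure (walk_measure E x) {\<omega>. \<forall>i\<le>n. \<omega> i = y i} =
      emeasure (walk.CI E x {0..<Suc n}) (X (Suc n))"
    unfolding walk_measure_def using walk.lim[OF _ X_sets] by simp
  also have "\<dots> = emeasure (walk.C E x 0 (Suc n) (\<lambda>_. undefined)) (X (Suc n))"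
  proof -
    have "prod_emb {0..<Suc n} ?M {0..<Suc n} (X (Suc n)) = X (Suc n)"
      by (rule prod_emb_id) (auto simp: X_def PiE_iff)
    then show ?thesis
      using walk.emeasure_CI[OF subset_refl X_sets[of "Suc n"]] by simp
  qed
  also have "\<dots> = (\<Prod>i<Suc n. emeasure (walk_kernel E x i y) {y i})"
    by (rule C)
  also have "\<dots> = indicator {y 0} x * (\<Prod>i<n. ennreal (pmf (walk_step E (y i)) (y (Suc i))))"
    by (simp add: prod.lessThan_Suc_shift walk_kernel_def emeasure_pmf_single indicator_def
             del: prod.lessThan_Suc)
  finally show ?thesis .
qed

definition recurrent :: "'a set \<Rightarrow> ('a \<times> 'a) set \<Rightarrow> bool" where
  "recurrent V E \<longleftrightarrow> (\<forall>x\<in>V. AE \<omega> in walk_measure E x. \<exists>n>0. \<omega> n = x)"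

end

theory Submission
  imports Defs
begin

text \<open>The theorem is a Liouville property: on a recurrent graph every nonnegative superharmonic
  function is constant.

  On a graph the balls of radius \<open>1\<close> are the vertices and the balls of radius \<open>2\<close> are the closed
  neighborhoods. So a doubling measure \<open>\<mu>\<close> is given by its point masses, which are positive and
  finite, and if \<open>C\<^sub>\<mu> \<le> deg + 1\<close>, then the ratio of these two balls alone gives
  \<open>\<mu>{x} + (\<Sum>z\<sim>x. \<mu>{z}) \<le> (deg + 1) \<mu>{x}\<close>: the function \<open>x \<mapsto> \<mu>{x}\<close> is superharmonic
  (\<open>doubling_measure_point_masses_superharmonic\<close>). By the Liouville property it is a constant
  \<open>\<alpha>\<close>, so \<open>\<mu>\<close> is \<open>\<alpha>\<close> times the counting measure. The doubling constant of
  the counting measure is its local one because the local case is critical, and that is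
  \<open>deg + 1\<close>; scaling does not change it. Hence no doubling measure has a constant below
  \<open>deg + 1\<close>, and the multiples of the counting measure are exactly those that attain it.

  The Liouville property (\<open>recurrent_superharmonic_constant\<close>) comes from a bound by hitting
  probabilities. Let \<open>q\<^sub>m(a)\<close> be the probability that the walk from \<open>a\<close> is not at \<open>x\<close> at any of the times
  \<open>1, \<dots>, m\<close>. Induction on \<open>m\<close> shows that a nonnegative superharmonic \<open>f\<close> satisfies
  \<open>f(a) \<ge> f(x) (1 - q\<^sub>m(a))\<close>. Recurrence says that \<open>q\<^sub>m(x)\<close> tends to \<open>0\<close>; conditioning on the
  first step from \<open>x\<close>, so does \<open>q\<^sub>m(z)\<close> for each neighbor \<open>z\<close> of \<open>x\<close>. So \<open>f(z) \<ge> f(x)\<close> whenever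
  \<open>z\<close> and \<open>x\<close> are adjacent, and since adjacency is symmetric and the graph is connected,
  \<open>f\<close> is constant.\<close>

section \<open>The probability of avoiding a vertex\<close>

text \<open>On a graph whose vertices each have a neighbor, and only finitely many, this is the
  probability that the walk from \<open>a\<close> is not at \<open>x\<close> at any of the times \<open>1, \<dots>, m\<close>, computed by
  conditioning on the first step. Time \<open>0\<close> is left out, so that for \<open>a = x\<close> it is the
  probability of no return.\<close>

primrec avoid_prob :: "('a \<times> 'a) set \<Rightarrow> 'a \<Rightarrow> nat \<Rightarrow> 'a \<Rightarrow> real" where
  "avoid_prob E x 0 a = 1"
| "avoid_prob E x (Suc m) a = (\<Sum>z\<in>E `` {a} - {x}. avoid_prob E x m z) / real (card (E `` {a}))"

lemma avoid_prob_nonneg: "0 \<le> avoid_prob E x m a"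
  by (induction m arbitrary: a) (auto intro!: divide_nonneg_nonneg sum_nonneg)

lemma sets_walk_measure [measurable_cong]:
  "sets (walk_measure E s) = sets (Pi\<^sub>M UNIV (\<lambda>_. count_space UNIV))"
  unfolding walk_measure_def by simp

lemma space_walk_measure: "space (walk_measure E s) = UNIV"
  unfolding walk_measure_def by (simp add: space_PiM)

lemma coordinate_measurable_walk [measurable]:
  "(\<lambda>\<omega>. \<omega> i) \<in> walk_measure E s \<rightarrow>\<^sub>M count_space UNIV"
  by simp

lemma avoid_event_sets:
  "{\<omega>. (\<forall>i\<le>n. \<omega> i = y i) \<and> (\<forall>i\<in>{n<..n + m}. \<omega> i \<noteq> x)} \<in> sets (walk_measure E s)"
proof -
  have "{\<omega>\<in>space (walk_measure E s). (\<forall>i\<le>n. \<omega> i = y i) \<and> (\<forall>i\<in>{n<..n + m}. \<omega> i \<noteq> x)}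
      \<in> sets (walk_measure E s)"
    by measurable
  then show ?thesis by (simp add: space_walk_measure)
qed

section \<open>Superharmonic functions on recurrent graphs\<close>

locale locally_finite_graph = simple_connected_graph +
  assumes finite_neighbors: "a \<in> V \<Longrightarrow> finite (E `` {a})"
    and no_isolated: "a \<in> V \<Longrightarrow> E `` {a} \<noteq> {}"
begin

text \<open>The link between the recursion and the law of the walk. The prescribed path
  \<open>y 0, \<dots>, y n\<close> takes the place of the Markov property: the next step of the walk splits the event
  into events of the same kind for the paths that are longer by one vertex, so the probabilities of
  cylinders suffice. Equality holds too, but it would require discarding the null set of
  trajectories that leave the graph.\<close>

lemma walk_avoid_lower_bound:
  assumes "y n \<in> V"
  shows "emeasure (walk_measure E s) {\<omega>. \<forall>i\<le>n. \<omega> i = y i} * ennreal (avoid_prob E x m (y n))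
    \<le> emeasure (walk_measure E s) {\<omega>. (\<forall>i\<le>n. \<omega> i = y i) \<and> (\<forall>i\<in>{n<..n + m}. \<omega> i \<noteq> x)}"
  using assms
proof (induction m arbitrary: n y)
  case 0
  then show ?case by simp
next
  case (Suc m)
  let ?P = "emeasure (walk_measure E s)"
  let ?N = "E `` {y n}"
  define c where "c = ?P {\<omega>. \<forall>i\<le>n. \<omega> i = y i}"
  define B where "B z = {\<omega>. (\<forall>i\<le>Suc n. \<omega> i = (y(Suc n := z)) i) \<and>
    (\<forall>i\<in>{Suc n<..Suc n + m}. \<omega> i \<noteq> x)}" for z
  have fin: "finite ?N" and ne: "?N \<noteq> {}"
    using finite_neighbors no_isolated Suc.prems by auto
  have B_sets: "B z \<in> sets (walk_measure E s)" for z
    unfolding B_def by (rule avoid_event_sets)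
  have cyl: "?P {\<omega>. \<forall>i\<le>Suc n. \<omega> i = (y(Suc n := z)) i} = c * ennreal (1 / real (card ?N))"
    if z: "z \<in> ?N" for z
  proof -
    have "pmf (walk_step E (y n)) z = 1 / real (card ?N)"
      using fin ne z by (simp add: walk_step_def)
    then show ?thesis
      unfolding c_def emeasure_walk_measure by (simp add: mult.assoc)
  qed
  have step: "c * ennreal (1 / real (card ?N)) * ennreal (avoid_prob E x m z) \<le> ?P (B z)"
    if z: "z \<in> ?N" for z
  proof -
    have "z \<in> V" using z edges by auto
    then show ?thesis
      using Suc.IH[of "y(Suc n := z)" "Suc n"] cyl[OF z] by (simp add: B_def)
  qed
  have "c * ennreal (avoid_prob E x (Suc m) (y n))
      = (\<Sum>z\<in>?N - {x}. c * ennreal (1 / real (card ?N)) * ennreal (avoid_prob E x m z))"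
  proof -
    have "ennreal (avoid_prob E x (Suc m) (y n))
        = (\<Sum>z\<in>?N - {x}. ennreal (1 / real (card ?N) * avoid_prob E x m z))"
      by (subst sum_ennreal) (auto simp: avoid_prob_nonneg sum_divide_distrib)
    then show ?thesis
      by (simp only: sum_distrib_left mult.assoc ennreal_mult' avoid_prob_nonneg
          zero_le_divide_1_iff of_nat_0_le_iff)
  qed
  also have "\<dots> \<le> (\<Sum>z\<in>?N - {x}. ?P (B z))"
    by (rule sum_mono) (use step in auto)
  also have "\<dots> = ?P (\<Union>z\<in>?N - {x}. B z)"
  proof (rule sum_emeasure)
    show "disjoint_family_on B (?N - {x})"
      by (fastforce simp: disjoint_family_on_def B_def)
  qed (use B_sets fin in auto)
  also have "\<dots> \<le> ?P {\<omega>. (\<forall>i\<le>n. \<omega> i = y i) \<and> (\<forall>i\<in>{n<..n + Suc m}. \<omega> i \<noteq> x)}"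
  proof (rule emeasure_mono [OF _ avoid_event_sets], rule UN_least, rule subsetI)
    fix z \<omega> assume z: "z \<in> ?N - {x}" and w: "\<omega> \<in> B z"
    have "\<omega> i \<noteq> x" if "i \<in> {n<..n + Suc m}" for i
    proof (cases "i = Suc n")
      case True
      then show ?thesis using z w by (auto simp: B_def)
    next
      case False
      then show ?thesis using w that by (auto simp: B_def)
    qed
    moreover have "\<omega> i = y i" if "i \<le> n" for i
      using w that by (auto simp: B_def)
    ultimately show "\<omega> \<in> {\<omega>. (\<forall>i\<le>n. \<omega> i = y i) \<and> (\<forall>i\<in>{n<..n + Suc m}. \<omega> i \<noteq> x)}"
      by blast
  qed
  finally show ?case by (simp add: c_def)
qed

lemma recurrent_avoid_prob_tendsto_0:
  assumes "recurrent V E" and x: "x \<in> V"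
  shows "(\<lambda>m. avoid_prob E x m x) \<longlonglongrightarrow> 0"
proof -
  let ?P = "emeasure (walk_measure E x)"
  define A where "A m = {\<omega>. (\<forall>i\<le>(0::nat). \<omega> i = x) \<and> (\<forall>i\<in>{0<..0 + m}. \<omega> i \<noteq> x)}" for m
  have A_sets: "A m \<in> sets (walk_measure E x)" for m
    unfolding A_def by (rule avoid_event_sets)
  have start: "?P {\<omega>. \<forall>i\<le>0. \<omega> i = x} = 1"
    using emeasure_walk_measure [of E x 0 "\<lambda>_. x"] by simp
  have bound: "ennreal (avoid_prob E x m x) \<le> ?P (A m)" for m
    using walk_avoid_lower_bound [of "\<lambda>_. x" 0 x x m] x start by (simp add: A_def)
  have fin: "?P (A m) \<noteq> \<infinity>" for m
  proof -
    have "?P (A m) \<le> ?P (A 0)"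
      by (rule emeasure_mono [OF _ A_sets]) (auto simp: A_def)
    also have "\<dots> = 1" using start by (simp add: A_def)
    finally show ?thesis by (auto simp: top_unique)
  qed
  have "(\<lambda>m. ?P (A m)) \<longlonglongrightarrow> ?P (\<Inter>m. A m)"
    by (rule Lim_emeasure_decseq) (use A_sets fin in \<open>auto simp: decseq_def A_def\<close>)
  moreover have "?P (\<Inter>m. A m) = 0"
  proof -
    have "AE \<omega> in walk_measure E x. \<exists>n>0. \<omega> n = x"
      using assms by (simp add: recurrent_def)
    then have "AE \<omega> in walk_measure E x. \<omega> \<notin> (\<Inter>m. A m)"
      by eventually_elim (fastforce simp: A_def)
    moreover have "(\<Inter>m. A m) \<in> sets (walk_measure E x)"
      using A_sets by auto
    ultimately have "(\<Inter>m. A m) \<in> null_sets (walk_measure E x)"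
      by (simp add: AE_iff_null_sets)
    then show ?thesis by (rule null_setsD1)
  qed
  ultimately have lim: "(\<lambda>m. ?P (A m)) \<longlonglongrightarrow> 0" by simp
  have "(\<lambda>m. ennreal (avoid_prob E x m x)) \<longlonglongrightarrow> 0"
    by (rule tendsto_sandwich [OF _ _ tendsto_const lim]) (simp_all add: bound)
  then have "(\<lambda>m. ennreal (avoid_prob E x m x)) \<longlonglongrightarrow> ennreal 0" by simp
  then show ?thesis
    by (rule tendsto_ennrealD) (simp_all add: avoid_prob_nonneg)
qed

text \<open>The right weight of a neighbor \<open>z\<close> in the induction step is \<open>1 - q\<^sub>m(z)\<close>, unless
  \<open>z = x\<close>, where the walk has hit \<open>x\<close> and the weight is \<open>1\<close>; in both cases \<open>f x\<close> times the weight
  is at most \<open>f z\<close>.\<close>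

lemma superharmonic_ge_hit_prob:
  assumes nonneg: "\<And>a. a \<in> V \<Longrightarrow> 0 \<le> f a"
    and superharmonic: "\<And>a. a \<in> V \<Longrightarrow> (\<Sum>z\<in>E `` {a}. f z) \<le> real (card (E `` {a})) * f a"
    and x: "x \<in> V" and a: "a \<in> V"
  shows "f x * (1 - avoid_prob E x m a) \<le> f a"
  using a
proof (induction m arbitrary: a)
  case 0
  then show ?case using nonneg by simp
next
  case (Suc m)
  let ?N = "E `` {a}" and ?u = "\<lambda>z. if z = x then 0 else avoid_prob E x m z"
  have fin: "finite ?N" and card: "real (card ?N) > 0"
    using finite_neighbors no_isolated Suc.prems by (auto simp: card_gt_0_iff)
  have avoid: "avoid_prob E x (Suc m) a * real (card ?N) = (\<Sum>z\<in>?N. ?u z)"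
  proof -
    have "(\<Sum>z\<in>?N. ?u z) = (\<Sum>z\<in>?N - {x}. ?u z)"
      using fin by (intro sum.mono_neutral_right) auto
    then show ?thesis using card by simp
  qed
  have "real (card ?N) * (f x * (1 - avoid_prob E x (Suc m) a))
      = f x * (real (card ?N) - avoid_prob E x (Suc m) a * real (card ?N))"
    by (simp add: algebra_simps)
  also have "\<dots> = (\<Sum>z\<in>?N. f x * (1 - ?u z))"
    unfolding avoid by (simp add: sum_distrib_left [symmetric] sum_subtractf)
  also have "\<dots> \<le> (\<Sum>z\<in>?N. f z)"
    using Suc.IH edges by (intro sum_mono) auto
  also have "\<dots> \<le> real (card ?N) * f a"
    by (rule superharmonic [OF Suc.prems])
  finally show ?case using card by simp
qed

text \<open>Recurrence makes \<open>f\<close> monotone along each edge, in both directions.\<close>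

theorem recurrent_superharmonic_constant:
  assumes rec: "recurrent V E"
    and nonneg: "\<And>a. a \<in> V \<Longrightarrow> 0 \<le> f a"
    and superharmonic: "\<And>a. a \<in> V \<Longrightarrow> (\<Sum>z\<in>E `` {a}. f z) \<le> real (card (E `` {a})) * f a"
    and "x \<in> V" "y \<in> V"
  shows "f x = f y"
proof -
  have le: "f x \<le> f z" if edge: "(x, z) \<in> E" for x z
  proof -
    let ?k = "real (card (E `` {x}))"
    have xV: "x \<in> V" and zV: "z \<in> V" using edge edges by auto
    have zx: "z \<in> E `` {x} - {x}" using edge no_loops by (auto simp: irrefl_def)
    have fin: "finite (E `` {x})" using finite_neighbors xV by simp
    have k: "?k > 0" using fin edge by (auto simp: card_gt_0_iff)
    have *: "f x * (1 - ?k * avoid_prob E x (Suc m) x) \<le> f z" for m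
    proof -
      \<comment> \<open>A walk from \<open>x\<close> moves to \<open>z\<close> with probability \<open>1 / ?k\<close>, so it can avoid \<open>x\<close> from
        \<open>z\<close> on at most \<open>?k\<close> times as often as it fails to return.\<close>
      have "avoid_prob E x m z \<le> (\<Sum>z\<in>E `` {x} - {x}. avoid_prob E x m z)"
        using zx fin by (intro member_le_sum) (auto simp: avoid_prob_nonneg)
      also have "\<dots> = ?k * avoid_prob E x (Suc m) x" using k by simp
      finally have "f x * (1 - ?k * avoid_prob E x (Suc m) x) \<le> f x * (1 - avoid_prob E x m z)"
        using nonneg [OF xV] by (intro mult_left_mono) auto
      also have "\<dots> \<le> f z"
        using superharmonic_ge_hit_prob [of f x z m] nonneg superharmonic xV zV by blast
      finally show ?thesis .
    qed
    have "(\<lambda>m. avoid_prob E x (Suc m) x) \<longlonglongrightarrow> 0"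
      using recurrent_avoid_prob_tendsto_0 [OF rec xV] by (rule LIMSEQ_Suc)
    then have "(\<lambda>m. f x * (1 - ?k * avoid_prob E x (Suc m) x)) \<longlonglongrightarrow> f x * (1 - ?k * 0)"
      by (intro tendsto_intros)
    then have "f x * (1 - ?k * 0) \<le> f z"
      by (rule LIMSEQ_le_const2) (use * in blast)
    then show ?thesis by simp
  qed
  have eq: "f x = f z" if "(x, z) \<in> E" for x z
    using le [OF that] le [OF symD [OF sym_edges that]] by simp
  have "(x, y) \<in> E\<^sup>*" using connected assms by simp
  then show ?thesis by (induction) (auto dest: eq)
qed

end

section \<open>Doubling measures\<close>

context Metric_space
begin

lemma doubling_measure_iterate:
  assumes "\<And>x r. x \<in> M \<Longrightarrow> r > 0 \<Longrightarrow>
      emeasure \<mu> (mball x (2 * r)) \<le> ennreal C * emeasure \<mu> (mball x r)"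
    and "x \<in> M" "r > 0"
  shows "emeasure \<mu> (mball x (2 ^ n * r)) \<le> ennreal C ^ n * emeasure \<mu> (mball x r)"
proof (induction n)
  case (Suc n)
  have "emeasure \<mu> (mball x (2 ^ Suc n * r)) \<le> ennreal C * emeasure \<mu> (mball x (2 ^ n * r))"
    using assms(1) [of x "2 ^ n * r"] assms(2,3) by (simp add: mult.assoc)
  also have "\<dots> \<le> ennreal C * (ennreal C ^ n * emeasure \<mu> (mball x r))"
    by (rule mult_left_mono [OF Suc.IH]) simp
  finally show ?case by (simp add: mult.assoc)
qed simp

lemma doubling_measure_mball_sets:
  assumes "doubling_measure \<mu>"
  shows "mball x r \<in> sets \<mu>"
proof -
  have "mball x r \<in> borel_sets"
    unfolding borel_sets_def by (rule sigma_sets.Basic) simp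
  moreover have "borel_sets \<subseteq> sets \<mu>"
    using assms by (simp add: doubling_measure_def borel_regular_def)
  ultimately show ?thesis by blast
qed

text \<open>Each of two balls lies in a dilate of the other by a power of \<open>2\<close>, so the doubling
  inequality carries positivity and finiteness from one ball to all balls.\<close>

lemma doubling_measure_mball_pos_finite:
  assumes "doubling_measure \<mu>" and x: "x \<in> M" and r: "r > 0"
  shows "0 < emeasure \<mu> (mball x r)" "emeasure \<mu> (mball x r) < \<infinity>"
proof -
  obtain C x0 r0 where C: "\<And>x r. x \<in> M \<Longrightarrow> r > 0 \<Longrightarrow>
      emeasure \<mu> (mball x (2 * r)) \<le> ennreal C * emeasure \<mu> (mball x r)"
    and x0: "x0 \<in> M" "r0 > 0" "0 < emeasure \<mu> (mball x0 r0)" "emeasure \<mu> (mball x0 r0) < \<infinity>"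
    using assms(1) unfolding doubling_measure_def by blast
  have cover: "\<exists>n. mball a s \<subseteq> mball b (2 ^ n * t)" if "b \<in> M" "t > 0" for a b s t
  proof -
    obtain n where "(d a b + s) / t < 2 ^ n"
      using real_arch_pow [of 2 "(d a b + s) / t"] by auto
    then have "d a b + s \<le> 2 ^ n * t" using that by (simp add: field_simps)
    then show ?thesis using mball_subset that by blast
  qed
  have mono: "\<exists>n. emeasure \<mu> (mball a s) \<le> ennreal C ^ n * emeasure \<mu> (mball b t)"
    if bt: "b \<in> M" "t > 0" for a b s t
  proof -
    obtain n where "mball a s \<subseteq> mball b (2 ^ n * t)"
      using cover [OF bt] by blast
    then have "emeasure \<mu> (mball a s) \<le> emeasure \<mu> (mball b (2 ^ n * t))"
      by (rule emeasure_mono) (rule doubling_measure_mball_sets [OF assms(1)])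
    also have "\<dots> \<le> ennreal C ^ n * emeasure \<mu> (mball b t)"
      by (rule doubling_measure_iterate [OF C bt])
    finally show ?thesis by blast
  qed
  show "0 < emeasure \<mu> (mball x r)"
    using mono [OF x r, of x0 r0] x0(3) by (auto simp: zero_less_iff_neq_zero)
  obtain n where "emeasure \<mu> (mball x r) \<le> ennreal C ^ n * emeasure \<mu> (mball x0 r0)"
    using mono [OF x0(1,2)] by blast
  also have "\<dots> < \<infinity>"
    using x0(4) by (simp add: ennreal_mult_less_top power_less_top_ennreal)
  finally show "emeasure \<mu> (mball x r) < \<infinity>" .
qed

lemma mball_ratio_le_doubling_const:
  assumes "x \<in> M" "r > 0"
  shows "emeasure \<mu> (mball x (2 * r)) / emeasure \<mu> (mball x r) \<le> doubling_const \<mu>"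
  unfolding doubling_const_def
  by (rule SUP_upper2 [OF assms(1)], rule SUP_upper2 [of r]) (use assms in auto)

lemma doubling_const_scale_measure:
  assumes "0 < \<alpha>" "\<alpha> < \<infinity>"
  shows "doubling_const (scale_measure \<alpha> \<mu>) = doubling_const \<mu>"
proof -
  have "\<alpha> * a / (\<alpha> * b) = a / b" for a b
    using assms divide_mult_eq [of \<alpha> a b] by (simp add: mult.commute)
  then show ?thesis
    unfolding doubling_const_def emeasure_scale_measure by simp
qed

lemma doubling_measureI:
  assumes "borel_regular \<mu>" "doubling_const \<mu> < \<infinity>"
    and pos: "\<And>x r. x \<in> M \<Longrightarrow> 0 < r \<Longrightarrow> 0 < emeasure \<mu> (mball x r)"
    and "x0 \<in> M" "r0 > 0" "emeasure \<mu> (mball x0 r0) < \<infinity>"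
  shows "doubling_measure \<mu>"
proof -
  \<comment> \<open>The summand \<open>1\<close> makes the constant positive.\<close>
  define C where "C = enn2real (doubling_const \<mu>) + 1"
  have C: "C > 0" unfolding C_def by (simp add: add_nonneg_pos)
  have leC: "doubling_const \<mu> \<le> ennreal C"
    using assms(2) unfolding C_def by (cases "doubling_const \<mu>") (auto simp: ennreal_leI)
  have "emeasure \<mu> (mball x (2 * r)) \<le> ennreal C * emeasure \<mu> (mball x r)"
    if "x \<in> M" "r > 0" for x r
    \<comment> \<open>On a ball of infinite measure the quotient is \<open>0\<close> and says nothing.\<close>
  proof (cases "emeasure \<mu> (mball x r) = \<infinity>")
    case True
    then show ?thesis using C by (simp add: ennreal_mult_top)
  next
    case False
    let ?a = "emeasure \<mu> (mball x (2 * r))" and ?b = "emeasure \<mu> (mball x r)"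
    have "?a = ?a / ?b * ?b"
      using False pos [OF that] mult_divide_eq_ennreal [of ?b ?a]
      by (simp add: ennreal_times_divide mult.commute)
    also have "\<dots> \<le> ennreal C * ?b"
      by (intro mult_right_mono order_trans [OF mball_ratio_le_doubling_const leC] that) simp
    finally show ?thesis .
  qed
  then show ?thesis
    unfolding doubling_measure_def
    using assms(1) C pos [OF assms(4,5)] assms(4-6)
    by (intro conjI exI [of _ C] bexI [of _ x0] exI [of _ r0]) auto
qed

end

section \<open>Doubling measures on graphs\<close>

context simple_connected_graph
begin

interpretation graph: Metric_space V "path_dist E"
  by (rule Metric_space_path_dist)

lemma path_dist_less_2_iff:
  assumes "x \<in> V" "y \<in> V"
  shows "path_dist E x y < 2 \<longleftrightarrow> x = y \<or> (x, y) \<in> E"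
proof -
  define n where "n = (LEAST n. (x, y) \<in> E ^^ n)"
  have "\<exists>n. (x, y) \<in> E ^^ n"
    using connected [OF assms] by (simp add: rtrancl_power)
  then have n: "(x, y) \<in> E ^^ n" unfolding n_def by (rule LeastI_ex)
  have least: "n \<le> k" if "(x, y) \<in> E ^^ k" for k
    unfolding n_def using that by (rule Least_le)
  have "path_dist E x y < 2 \<longleftrightarrow> n = 0 \<or> n = 1"
    by (auto simp: path_dist_def n_def [symmetric])
  also have "\<dots> \<longleftrightarrow> x = y \<or> (x, y) \<in> E"
    using n least [of 0] least [of 1] by (auto simp: le_Suc_eq)
  finally show ?thesis .
qed

lemma mball_1: "x \<in> V \<Longrightarrow> graph.mball x 1 = {x}"
proof -
  assume x: "x \<in> V"
  have "path_dist E x y < 1 \<longleftrightarrow> x = y" if "y \<in> V" for y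
    using graph.zero [OF x that] by (simp add: path_dist_def)
  then show ?thesis using x by auto
qed

lemma mball_2: "x \<in> V \<Longrightarrow> graph.mball x 2 = insert x (E `` {x})"
  using edges by (auto simp: path_dist_less_2_iff)

lemma borel_sets_eq: "graph.borel_sets = Pow V"
proof
  have "openin graph.mtopology U" if "U \<subseteq> V" for U
    unfolding graph.openin_mtopology
  proof (intro conjI allI impI)
    fix x assume "x \<in> U"
    then show "\<exists>r>0. graph.mball x r \<subseteq> U"
      using mball_1 [of x] that by (intro exI [of _ 1]) auto
  qed (rule that)
  then show "Pow V \<subseteq> graph.borel_sets"
    unfolding graph.borel_sets_def by (auto intro: sigma_sets.Basic)
  show "graph.borel_sets \<subseteq> Pow V"
    unfolding graph.borel_sets_def
    using sigma_sets_into_sp [of "{U. openin graph.mtopology U}" V]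
      openin_subset [of graph.mtopology] by auto
qed

text \<open>The metric is discrete, so Borel regularity only fixes the \<open>\<sigma>\<close>-algebra.\<close>

lemma borel_regular_iff: "graph.borel_regular \<mu> \<longleftrightarrow> sets \<mu> = Pow V"
proof
  assume "graph.borel_regular \<mu>"
  then show "sets \<mu> = Pow V"
    using sets.sets_into_space unfolding graph.borel_regular_def borel_sets_eq by blast
next
  assume s: "sets \<mu> = Pow V"
  then have "space \<mu> = V"
    using sets.sets_into_space [of _ \<mu>] sets.top [of \<mu>] by blast
  with s show "graph.borel_regular \<mu>"
    unfolding graph.borel_regular_def borel_sets_eq by auto
qed

text \<open>Countability of the vertex set is what makes a measure on it determined by its point
  masses.\<close>

lemma countable_vertices:
  assumes "\<And>x. x \<in> V \<Longrightarrow> finite (E `` {x})"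
  shows "countable V"
proof -
  obtain x where x: "x \<in> V" using nonempty by blast
  have "countable (E `` Y)" if "countable Y" for Y
  proof -
    have "countable (E `` {y})" for y
    proof (cases "y \<in> V")
      case False
      then have "E `` {y} = {}" using edges by blast
      then show ?thesis by simp
    qed (simp add: assms countable_finite)
    moreover have "E `` Y = (\<Union>y\<in>Y. E `` {y})" by blast
    ultimately show ?thesis using that by simp
  qed
  then have "countable (E\<^sup>* `` {x})" by (rule countable_rtrancl) simp_all
  moreover have "V \<subseteq> E\<^sup>* `` {x}" using connected x by blast
  ultimately show ?thesis by (rule countable_subset [rotated])
qed

lemma local_doubling_const_count_space:
  assumes "regular_of_degree V E deg"
  shows "graph.local_doubling_const (count_space V) = of_nat (deg + 1)"
proof -
  have "emeasure (count_space V) (graph.mball x 2) / emeasure (count_space V) (graph.mball x 1)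
      = of_nat (deg + 1)" if x: "x \<in> V" for x
  proof -
    have "x \<notin> E `` {x}" using no_loops by (auto simp: irrefl_def)
    moreover have "insert x (E `` {x}) \<subseteq> V" using x edges by auto
    ultimately show ?thesis
      using assms x by (simp add: mball_1 mball_2 regular_of_degree_def emeasure_count_space divide_ennreal_def)
  qed
  then show ?thesis
    using nonempty by (simp add: graph.local_doubling_const_def)
qed

lemma doubling_measure_point_masses_superharmonic:
  assumes deg: "regular_of_degree V E deg" and \<mu>: "graph.doubling_measure \<mu>"
    and le: "graph.doubling_const \<mu> \<le> of_nat (deg + 1)" and x: "x \<in> V"
  shows "(\<Sum>z\<in>E `` {x}. measure \<mu> {z}) \<le> real (card (E `` {x})) * measure \<mu> {x}"
proof -
  let ?f = "\<lambda>x. measure \<mu> {x}"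
  have sets: "sets \<mu> = Pow V"
    using \<mu> by (simp add: graph.doubling_measure_def borel_regular_iff)
  have fin: "finite (E `` {x})" and card: "card (E `` {x}) = deg"
    using deg x by (auto simp: regular_of_degree_def)
  have pos: "0 < emeasure \<mu> {a}" "emeasure \<mu> {a} < \<infinity>" if "a \<in> V" for a
    using graph.doubling_measure_mball_pos_finite [OF \<mu> that, of 1] that by (auto simp: mball_1)
  have em: "emeasure \<mu> {a} = ennreal (?f a)" if "a \<in> V" for a
    using pos(2) [OF that] by (simp add: emeasure_eq_ennreal_measure)
  have fpos: "0 < ?f x"
    using pos(1) [OF x] em [OF x] by (simp add: measure_nonneg)
  have nbV: "insert x (E `` {x}) \<subseteq> V" using x edges by auto
  have "emeasure \<mu> (insert x (E `` {x})) = (\<Sum>z\<in>insert x (E `` {x}). emeasure \<mu> {z})"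
    using fin nbV sets by (intro emeasure_eq_sum_singleton) auto
  also have "\<dots> = (\<Sum>z\<in>insert x (E `` {x}). ennreal (?f z))"
    using nbV em by (intro sum.cong) auto
  also have "\<dots> = ennreal (\<Sum>z\<in>insert x (E `` {x}). ?f z)"
    by (rule sum_ennreal) simp
  also have "(\<Sum>z\<in>insert x (E `` {x}). ?f z) = ?f x + (\<Sum>z\<in>E `` {x}. ?f z)"
    using fin no_loops by (subst sum.insert) (auto simp: irrefl_def)
  finally have "ennreal ((?f x + (\<Sum>z\<in>E `` {x}. ?f z)) / ?f x)
      = emeasure \<mu> (graph.mball x (2 * 1)) / emeasure \<mu> (graph.mball x 1)"
    using fpos x by (simp add: mball_1 mball_2 em divide_ennreal [symmetric] sum_nonneg)
  also have "\<dots> \<le> ennreal (real (deg + 1))"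
    using order_trans [OF graph.mball_ratio_le_doubling_const le] x
    by (simp only: ennreal_of_nat_eq_real_of_nat zero_less_one)
  finally have "(?f x + (\<Sum>z\<in>E `` {x}. ?f z)) / ?f x \<le> real (deg + 1)"
    by (subst (asm) ennreal_le_iff) simp_all
  then show ?thesis
    using fpos card by (simp add: divide_le_eq algebra_simps)
qed

text \<open>In degree \<open>0\<close> the graph is a single vertex, where there is nothing to prove; in every other
  case the walk moves, and the point masses are constant by the Liouville property.\<close>

lemma recurrent_doubling_measure_uniform:
  assumes deg: "regular_of_degree V E deg" and rec: "recurrent V E"
    and \<mu>: "graph.doubling_measure \<mu>"
    and le: "graph.doubling_const \<mu> \<le> of_nat (deg + 1)"
  shows "\<exists>\<alpha>>0. \<mu> = scale_measure (ennreal \<alpha>) (count_space V)"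
proof -
  let ?f = "\<lambda>x. measure \<mu> {x}"
  obtain w where w: "w \<in> V" using nonempty by blast
  have pos: "0 < emeasure \<mu> {a}" "emeasure \<mu> {a} < \<infinity>" if "a \<in> V" for a
    using graph.doubling_measure_mball_pos_finite [OF \<mu> that, of 1] that by (auto simp: mball_1)
  have const: "?f x = ?f w" if x: "x \<in> V" for x
  proof (cases "deg = 0")
    case True
    then have "E `` {a} = {}" if "a \<in> V" for a
      using deg that unfolding regular_of_degree_def by (metis card_0_eq)
    then have "E = {}" using edges by blast
    then show ?thesis using connected [OF x w] by simp
  next
    case False
    interpret locally_finite_graph V E
      by unfold_locales (use deg False in \<open>auto simp: regular_of_degree_def\<close>)
    show ?thesis
      using recurrent_superharmonic_constant [of ?f x w] rec x w
        doubling_measure_point_masses_superharmonic [OF deg \<mu> le] by simp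
  qed
  have "\<mu> = scale_measure (ennreal (?f w)) (count_space V)"
  proof (rule measure_eqI_countable)
    show "sets \<mu> = Pow V"
      using \<mu> by (simp add: graph.doubling_measure_def borel_regular_iff)
    show "countable V"
      using deg by (intro countable_vertices) (simp add: regular_of_degree_def)
    show "emeasure \<mu> {a} = emeasure (scale_measure (ennreal (?f w)) (count_space V)) {a}"
      if "a \<in> V" for a
      using pos(2) [OF that] const [OF that] that
      by (simp add: emeasure_eq_ennreal_measure)
  qed simp
  moreover have "?f w > 0"
    using pos [OF w] by (simp add: measure_def enn2real_positive_iff)
  ultimately show ?thesis by blast
qed

lemma doubling_measure_scaled_count_space:
  assumes "graph.doubling_const (count_space V) < \<infinity>" and \<alpha>: "0 < \<alpha>"
  shows "graph.doubling_measure (scale_measure (ennreal \<alpha>) (count_space V))"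
proof -
  obtain x where x: "x \<in> V" using nonempty by blast
  show ?thesis
  proof (rule graph.doubling_measureI [OF _ _ _ x zero_less_one])
    show "graph.doubling_const (scale_measure (ennreal \<alpha>) (count_space V)) < \<infinity>"
      using assms by (simp add: graph.doubling_const_scale_measure)
    show "0 < emeasure (scale_measure (ennreal \<alpha>) (count_space V)) (graph.mball y r)"
      if "y \<in> V" "0 < r" for y r
    proof -
      have "y \<in> graph.mball y r" using that by simp
      then have "graph.mball y r \<noteq> {}" by blast
      then show ?thesis
        using \<alpha> graph.mball_subset_mspace [of y r]
        by (simp add: zero_less_iff_neq_zero emeasure_count_space)
    qed
    show "emeasure (scale_measure (ennreal \<alpha>) (count_space V)) (graph.mball x 1) < \<infinity>"
      using x by (simp add: mball_1)
  qed (simp_all add: borel_regular_iff)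
qed

end

theorem lemma2p1:
  fixes V :: "'a set" and E :: "('a \<times> 'a) set" and deg :: nat
  assumes "simple_connected_graph V E"
    and "regular_of_degree V E deg"
    and "Metric_space.local_case_critical V (path_dist E) (count_space V)"
    and "recurrent V E"
  shows "Metric_space.least_doubling_const V (path_dist E) = of_nat (deg + 1) \<and>
    Metric_space.doubling_minimizers V (path_dist E) =
      {scale_measure (ennreal \<alpha>) (count_space V) | \<alpha>::real. \<alpha> > 0}"
proof -
  interpret simple_connected_graph V E by (rule assms(1))
  interpret graph: Metric_space V "path_dist E" by (rule Metric_space_path_dist)
  have count: "graph.doubling_const (count_space V) = of_nat (deg + 1)"
    using assms(3) local_doubling_const_count_space [OF assms(2)]
    by (simp add: graph.local_case_critical_def)
  have scaled: "graph.doubling_const (scale_measure (ennreal \<alpha>) (count_space V)) = of_nat (deg + 1)"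
      "graph.doubling_measure (scale_measure (ennreal \<alpha>) (count_space V))" if "\<alpha> > 0" for \<alpha>
    using that count graph.doubling_const_scale_measure [of "ennreal \<alpha>" "count_space V"]
      doubling_measure_scaled_count_space [of \<alpha>]
    by (simp_all add: ennreal_of_nat_eq_real_of_nat)
  note uniform = recurrent_doubling_measure_uniform [OF assms(2,4)]
  have lower: "of_nat (deg + 1) \<le> graph.doubling_const \<mu>" if \<mu>: "graph.doubling_measure \<mu>" for \<mu>
  \<comment> \<open>A measure with a smaller constant would be a multiple of the counting measure, whose
    constant is not smaller.\<close>
  proof (rule ccontr)
    assume less: "\<not> of_nat (deg + 1) \<le> graph.doubling_const \<mu>"
    then have "graph.doubling_const \<mu> \<le> of_nat (deg + 1)"
      by (simp only: not_le less_imp_le)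
    from uniform [OF \<mu> this] obtain \<alpha>
      where "\<alpha> > 0" "\<mu> = scale_measure (ennreal \<alpha>) (count_space V)" by blast
    with less scaled(1) show False by simp
  qed
  have least: "graph.least_doubling_const = of_nat (deg + 1)"
    unfolding graph.least_doubling_const_def
  proof (rule antisym)
    show "(INF \<mu>\<in>Collect graph.doubling_measure. graph.doubling_const \<mu>) \<le> of_nat (deg + 1)"
      using scaled [of 1] by (intro INF_lower2 [of "scale_measure (ennreal 1) (count_space V)"]) auto
  qed (rule INF_greatest, use lower in simp)
  moreover have "graph.doubling_minimizers =
      {scale_measure (ennreal \<alpha>) (count_space V) | \<alpha>::real. \<alpha> > 0}"
  proof (intro equalityI subsetI)
    fix \<mu> assume "\<mu> \<in> graph.doubling_minimizers"
    then show "\<mu> \<in> {scale_measure (ennreal \<alpha>) (count_space V) | \<alpha>::real. \<alpha> > 0}"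
      using uniform [of \<mu>] least by (auto simp: graph.doubling_minimizers_def)
  next
    fix \<mu> assume "\<mu> \<in> {scale_measure (ennreal \<alpha>) (count_space V) | \<alpha>::real. \<alpha> > 0}"
    then show "\<mu> \<in> graph.doubling_minimizers"
      using scaled least by (auto simp: graph.doubling_minimizers_def)
  qed
  ultimately show ?thesis by simp
qed

end
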